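(* Assume the set $\mathcal P$ of atoms is finite, and let $n\in\mathbb N$. For all in-models $M,M'$: (1) if $w,w'$ are worlds of $M,M'$ respectively and $M,w\equiv_n M',w'$, then $M,w\sim_n M',w'$; (2) if $s,s'$ are information states of $M,M'$ respectively and $M,s\equiv_n M',s'$, then $M,s\sim_n M',s'$.
   Context: Fix a set $\mathcal P$ of atoms. Formulas of $\mathcal L_{\Rrightarrow}$ are given by $\varphi ::= p \mid \bot \mid (\varphi\wedge\varphi)\mid(\varphi\to\varphi)\mid(\varphi\veebar\varphi)\mid(\varphi\Rrightarrow\varphi)$ with $p\in\mathcal P$, where $\veebar$ denotes inquisitive disjunction. Modal depth: $\mathrm{md}(p)=\mathrm{md}(\bot)=0$; $\mathrm{md}(\varphi\circ\psi)=\max(\mathrm{md}(\varphi),\mathrm{md}(\psi))$ for $\circ\in\{\wedge,\veebar,\to\}$; $\mathrm{md}(\varphi\Rrightarrow\psi)=\max(\mathrm{md}(\varphi),\mathrm{md}(\psi))+1$. An in-model is $M=\langle W,\Sigma,V\rangle$ where $W$ is a nonempty set, $\Sigma$ assigns to each $w\in W$ a set $\Sigma(w)$ of nonempty subsets of $W$, and $V:W\times\mathcal P\to\{0,1\}$. Support at $s\subseteq W$: $M,s\models p$ iff $V(w,p)=1$ for all $w\in s$; $M,s\models\bot$ iff $s=\emptyset$; $M,s\models\varphi\wedge\psi$ iff both; $M,s\models\varphi\veebar\psi$ iff $M,s\models\varphi$ or $M,s\models\psi$; $M,s\models\varphi\to\psi$ iff for all $t\subseteq s$, $M,t\models\varphi$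 implies $M,t\models\psi$; $M,s\models\varphi\Rrightarrow\psi$ iff for all $w\in s$ and $t\in\Sigma(w)$, $M,t\models\varphi$ implies $M,t\models\psi$. Truth: $M,w\models\varphi$ iff $M,\{w\}\models\varphi$. $M,w\equiv_n M',w'$ means $w$ and $w'$ make true the same formulas of modal depth at most $n$; $M,s\equiv_n M',s'$ means $s$ and $s'$ support the same formulas of modal depth at most $n$. Egli-Milner lifting of $R\subseteq X\times Y$: $A\overline R B$ iff every $a\in A$ has $b\in B$ with $aRb$ and every $b\in B$ has $a\in A$ with $aRb$. An $n$-bisimulation between $M=\langle W,\Sigma,V\rangle$ and $M'=\langle W',\Sigma',V'\rangle$ is a family $(Z_i)_{i\le n}$, $Z_i\subseteq W\times W'$, such that whenever $wZ_iw'$: $V(w,p)=V'(w',p)$ for all $p$; if $i>0$, every $s\in\Sigma(w)$ has some $s'\in\Sigma'(w')$ with $s\overline{Z_{i-1}}s'$, and every $s'\in\Sigma'(w')$ has some $s\in\Sigma(w)$ with $s\overline{Z_{i-1}}s'$. $M,w\sim_nM',w'$ iff some $n$-bisimulation has $wZ_nw'$; $M,s\sim_nM',s'$ iff some $n$-bisimulation has $s\overline{Z_n}s'$. *)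

theory Defs
  imports Main
begin

(* IDisj is inquisitive disjunction; MImp is the modality written with a triple arrow. *)
datatype (atoms: 'p) fm =
    Atom 'p
  | Bot
  | Conj "'p fm" "'p fm"
  | Imp "'p fm" "'p fm"
  | IDisj "'p fm" "'p fm"
  | MImp "'p fm" "'p fm"

(* The set P of atoms is an explicit parameter rather than a whole type, so that it may be empty. *)
definition formulas :: "'p set \<Rightarrow> 'p fm set" where
  "formulas P = {\<phi>. atoms \<phi> \<subseteq> P}"

primrec md :: "'p fm \<Rightarrow> nat" where
  "md (Atom p) = 0"
| "md Bot = 0"
| "md (Conj \<phi> \<psi>) = max (md \<phi>) (md \<psi>)"
| "md (Imp \<phi> \<psi>) = max (md \<phi>) (md \<psi>)"
| "md (IDisj \<phi> \<psi>) = max (md \<phi>) (md \<psi>)"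
| "md (MImp \<phi> \<psi>) = max (md \<phi>) (md \<psi>) + 1"

record ('w, 'p) model =
  worlds :: "'w set"
  nbhds :: "'w \<Rightarrow> 'w set set"
  val :: "'w \<Rightarrow> 'p \<Rightarrow> bool"

definition in_model :: "('w, 'p) model \<Rightarrow> bool" where
  "in_model M \<longleftrightarrow> worlds M \<noteq> {} \<and>
     (\<forall>w\<in>worlds M. \<forall>s\<in>nbhds M w. s \<subseteq> worlds M \<and> s \<noteq> {})"

primrec supports :: "('w, 'p) model \<Rightarrow> 'w set \<Rightarrow> 'p fm \<Rightarrow> bool" where
  "supports M s (Atom p) \<longleftrightarrow> (\<forall>w\<in>s. val M w p)"
| "supports M s Bot \<longleftrightarrow> s = {}"
| "supports M s (Conj \<phi> \<psi>) \<longleftrightarrow> supports M s \<phi> \<and> supports M s \<psi>"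
| "supports M s (Imp \<phi> \<psi>) \<longleftrightarrow> (\<forall>t. t \<subseteq> s \<longrightarrow> supports M t \<phi> \<longrightarrow> supports M t \<psi>)"
| "supports M s (IDisj \<phi> \<psi>) \<longleftrightarrow> supports M s \<phi> \<or> supports M s \<psi>"
| "supports M s (MImp \<phi> \<psi>) \<longleftrightarrow>
     (\<forall>w\<in>s. \<forall>t\<in>nbhds M w. supports M t \<phi> \<longrightarrow> supports M t \<psi>)"

definition true_at :: "('w, 'p) model \<Rightarrow> 'w \<Rightarrow> 'p fm \<Rightarrow> bool" where
  "true_at M w \<phi> \<longleftrightarrow> supports M {w} \<phi>"

definition world_equiv ::
  "'p set \<Rightarrow> nat \<Rightarrow> ('w, 'p) model \<Rightarrow> 'w \<Rightarrow> ('v, 'p) model \<Rightarrow> 'v \<Rightarrow> bool" where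
  "world_equiv P n M w M' w' \<longleftrightarrow>
     (\<forall>\<phi>\<in>formulas P. md \<phi> \<le> n \<longrightarrow> (true_at M w \<phi> \<longleftrightarrow> true_at M' w' \<phi>))"

definition state_equiv ::
  "'p set \<Rightarrow> nat \<Rightarrow> ('w, 'p) model \<Rightarrow> 'w set \<Rightarrow> ('v, 'p) model \<Rightarrow> 'v set \<Rightarrow> bool" where
  "state_equiv P n M s M' s' \<longleftrightarrow>
     (\<forall>\<phi>\<in>formulas P. md \<phi> \<le> n \<longrightarrow> (supports M s \<phi> \<longleftrightarrow> supports M' s' \<phi>))"

(* The Egli-Milner lifting is rel_set. Values Z i with i > n are irrelevant. *)
definition n_bisimulation ::
  "'p set \<Rightarrow> nat \<Rightarrow> ('w, 'p) model \<Rightarrow> ('v, 'p) model \<Rightarrow> (nat \<Rightarrow> 'w \<Rightarrow> 'v \<Rightarrow> bool) \<Rightarrow> bool" where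
  "n_bisimulation P n M M' Z \<longleftrightarrow>
     (\<forall>i\<le>n. \<forall>w w'. Z i w w' \<longrightarrow>
        w \<in> worlds M \<and> w' \<in> worlds M' \<and>
        (\<forall>p\<in>P. val M w p \<longleftrightarrow> val M' w' p) \<and>
        (i > 0 \<longrightarrow>
           (\<forall>s\<in>nbhds M w. \<exists>s'\<in>nbhds M' w'. rel_set (Z (i - 1)) s s') \<and>
           (\<forall>s'\<in>nbhds M' w'. \<exists>s\<in>nbhds M w. rel_set (Z (i - 1)) s s')))"

definition world_bisim ::
  "'p set \<Rightarrow> nat \<Rightarrow> ('w, 'p) model \<Rightarrow> 'w \<Rightarrow> ('v, 'p) model \<Rightarrow> 'v \<Rightarrow> bool" where
  "world_bisim P n M w M' w' \<longleftrightarrow> (\<exists>Z. n_bisimulation P n M M' Z \<and> Z n w w')"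

definition state_bisim ::
  "'p set \<Rightarrow> nat \<Rightarrow> ('w, 'p) model \<Rightarrow> 'w set \<Rightarrow> ('v, 'p) model \<Rightarrow> 'v set \<Rightarrow> bool" where
  "state_bisim P n M s M' s' \<longleftrightarrow> (\<exists>Z. n_bisimulation P n M M' Z \<and> rel_set (Z n) s s')"

end

theory Submission
  imports Defs
begin

text \<open>
  Over finitely many atoms, a finite set of formulas of depth at most \<open>n\<close> already determines a
  world up to \<open>n\<close>-bisimilarity. Given such a set \<open>F\<close> for \<open>n\<close>, a state matters only through the
  finite set of \<open>F\<close>-theories of its worlds. For every set \<open>X\<close> of theories there is a formula
  \<open>cover F X\<close> of the same depth, supported by exactly the states all of whose worlds have their
  theory in \<open>X\<close>. Hence the depth-\<open>n + 1\<close> formula whose antecedent is \<open>cover F X\<close> and whose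
  consequent is the inquisitive disjunction of the \<open>cover F (X - {T})\<close>, \<open>T \<in> X\<close>, is true at \<open>w\<close>
  iff no neighbourhood of \<open>w\<close> realizes exactly the theories in \<open>X\<close>, provided \<open>X \<noteq> {}\<close>; the empty
  \<open>X\<close> is harmless since neighbourhoods are nonempty. Together with the atoms these formulas form
  the set for \<open>n + 1\<close>.
\<close>

section \<open>Formulas of bounded depth and finite connectives\<close>

definition lang :: "'p set \<Rightarrow> nat \<Rightarrow> 'p fm set" where
  "lang P n = {\<phi> \<in> formulas P. md \<phi> \<le> n}"

definition neg :: "'p fm \<Rightarrow> 'p fm" where
  "neg \<phi> = Imp \<phi> Bot"

text \<open>The enumeration of a finite \<open>A\<close> is arbitrary; its order does not affect
  support. \<open>neg Bot\<close> serves as verum.\<close>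

definition bigconj :: "'p fm set \<Rightarrow> 'p fm" where
  "bigconj A = foldr Conj (SOME xs. set xs = A) (neg Bot)"

definition bigidisj :: "'p fm set \<Rightarrow> 'p fm" where
  "bigidisj A = foldr IDisj (SOME xs. set xs = A) Bot"

lemma set_some_list: "finite A \<Longrightarrow> set (SOME xs. set xs = A) = A"
  by (rule someI_ex) (rule finite_list)

lemma lang_simps [simp]:
  "Atom p \<in> lang P n \<longleftrightarrow> p \<in> P"
  "Bot \<in> lang P n"
  "Conj \<phi> \<psi> \<in> lang P n \<longleftrightarrow> \<phi> \<in> lang P n \<and> \<psi> \<in> lang P n"
  "Imp \<phi> \<psi> \<in> lang P n \<longleftrightarrow> \<phi> \<in> lang P n \<and> \<psi> \<in> lang P n"
  "IDisj \<phi> \<psi> \<in> lang P n \<longleftrightarrow> \<phi> \<in> lang P n \<and> \<psi> \<in> lang P n"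
  "MImp \<phi> \<psi> \<in> lang P (Suc n) \<longleftrightarrow> \<phi> \<in> lang P n \<and> \<psi> \<in> lang P n"
  "neg \<phi> \<in> lang P n \<longleftrightarrow> \<phi> \<in> lang P n"
  by (auto simp: lang_def formulas_def neg_def)

lemma bigconj_in_lang:
  assumes "finite A" "A \<subseteq> lang P n"
  shows "bigconj A \<in> lang P n"
proof -
  have "set xs \<subseteq> lang P n \<Longrightarrow> foldr Conj xs (neg Bot) \<in> lang P n" for xs
    by (induction xs) auto
  then show ?thesis
    using assms by (simp add: bigconj_def set_some_list)
qed

lemma bigidisj_in_lang:
  assumes "finite A" "A \<subseteq> lang P n"
  shows "bigidisj A \<in> lang P n"
proof -
  have "set xs \<subseteq> lang P n \<Longrightarrow> foldr IDisj xs Bot \<in> lang P n" for xs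
    by (induction xs) auto
  then show ?thesis
    using assms by (simp add: bigidisj_def set_some_list)
qed

section \<open>Persistence of support and the behaviour of negation\<close>

lemma supports_empty: "supports M {} \<phi>"
  by (induction \<phi>) auto

text \<open>Atoms and the modality are tested world by world, and implication already quantifies
  over all substates; the other cases follow by induction.\<close>

lemma supports_persistent: "supports M s \<phi> \<Longrightarrow> t \<subseteq> s \<Longrightarrow> supports M t \<phi>"
  by (induction \<phi> arbitrary: s t) (auto 4 4)

lemma supports_bigconj:
  assumes "finite A"
  shows "supports M s (bigconj A) \<longleftrightarrow> (\<forall>\<phi>\<in>A. supports M s \<phi>)"
proof -
  have "supports M s (foldr Conj xs (neg Bot)) \<longleftrightarrow> (\<forall>\<phi>\<in>set xs. supports M s \<phi>)" for xs
    by (induction xs) (auto simp: neg_def)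
  then show ?thesis
    using assms by (simp add: bigconj_def set_some_list)
qed

text \<open>The case \<open>s = {}\<close> comes from the final \<open>Bot\<close> of the fold; for
  nonempty \<open>A\<close> it is absorbed, because the empty state supports every formula.\<close>

lemma supports_bigidisj:
  assumes "finite A"
  shows "supports M s (bigidisj A) \<longleftrightarrow> s = {} \<or> (\<exists>\<phi>\<in>A. supports M s \<phi>)"
proof -
  have "supports M s (foldr IDisj xs Bot) \<longleftrightarrow> s = {} \<or> (\<exists>\<phi>\<in>set xs. supports M s \<phi>)" for xs
    by (induction xs) (auto simp: supports_empty)
  then show ?thesis
    using assms by (simp add: bigidisj_def set_some_list)
qed

text \<open>By persistence, a nonempty substate supporting \<open>\<phi>\<close> contains a world
  where \<open>\<phi>\<close> is true. So negations are tested world by world.\<close>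

lemma supports_neg: "supports M s (neg \<phi>) \<longleftrightarrow> (\<forall>w\<in>s. \<not> true_at M w \<phi>)"
proof
  assume "supports M s (neg \<phi>)"
  then show "\<forall>w\<in>s. \<not> true_at M w \<phi>"
    by (force simp: neg_def true_at_def)
next
  assume *: "\<forall>w\<in>s. \<not> true_at M w \<phi>"
  have "t = {}" if "t \<subseteq> s" "supports M t \<phi>" for t
  proof (rule ccontr)
    assume "t \<noteq> {}"
    then obtain w where "w \<in> t" by blast
    then have "true_at M w \<phi>"
      using supports_persistent[OF that(2), of "{w}"] by (simp add: true_at_def)
    with * \<open>w \<in> t\<close> that(1) show False by blast
  qed
  then show "supports M s (neg \<phi>)"
    by (simp add: neg_def)
qed

lemma true_at_neg: "true_at M w (neg \<phi>) \<longleftrightarrow> \<not> true_at M w \<phi>"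
  using supports_neg[of M "{w}" \<phi>] by (simp add: true_at_def)

section \<open>Theories of worlds, formulas describing them, and the finite basis\<close>

definition theory_of :: "('w, 'p) model \<Rightarrow> 'p fm set \<Rightarrow> 'w \<Rightarrow> 'p fm set" where
  "theory_of M F w = {\<phi> \<in> F. true_at M w \<phi>}"

text \<open>Characteristic formula of a theory \<open>T\<close> within \<open>F\<close>, meant for
  single worlds, where \<open>neg\<close> is classical.\<close>

definition type_fm :: "'p fm set \<Rightarrow> 'p fm set \<Rightarrow> 'p fm" where
  "type_fm F T = bigconj (T \<union> neg ` (F - T))"

text \<open>The double negation makes the disjunction of types a condition on single worlds.\<close>

definition cover :: "'p fm set \<Rightarrow> 'p fm set set \<Rightarrow> 'p fm" where
  "cover F X = neg (neg (bigidisj (type_fm F ` X)))"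

lemma true_at_type_fm:
  assumes "finite F" "T \<subseteq> F"
  shows "true_at M w (type_fm F T) \<longleftrightarrow> theory_of M F w = T"
proof -
  have "finite (T \<union> neg ` (F - T))"
    using assms finite_subset by auto
  then have "true_at M w (type_fm F T) \<longleftrightarrow> (\<forall>\<phi>\<in>T \<union> neg ` (F - T). true_at M w \<phi>)"
    by (simp add: type_fm_def true_at_def supports_bigconj)
  also have "\<dots> \<longleftrightarrow> theory_of M F w = T"
    using assms(2) by (auto simp: theory_of_def true_at_neg ball_Un)
  finally show ?thesis .
qed

lemma finite_subset_Pow: "finite F \<Longrightarrow> X \<subseteq> Pow F \<Longrightarrow> finite X"
  by (simp add: finite_subset)

text \<open>At a single world the disjunction says that the theory there lies in \<open>X\<close>;
  the outer negations extend this to all worlds of a state, which may differ in their choice of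
  disjunct.\<close>

lemma supports_cover:
  assumes "finite F" "X \<subseteq> Pow F"
  shows "supports M s (cover F X) \<longleftrightarrow> theory_of M F ` s \<subseteq> X"
proof -
  have "true_at M w (bigidisj (type_fm F ` X)) \<longleftrightarrow> (\<exists>T\<in>X. true_at M w (type_fm F T))" for w
    using finite_subset_Pow[OF assms] by (simp add: true_at_def supports_bigidisj)
  moreover have "true_at M w (type_fm F T) \<longleftrightarrow> theory_of M F w = T" if "T \<in> X" for w T
    using that assms by (intro true_at_type_fm) auto
  ultimately have "true_at M w (bigidisj (type_fm F ` X)) \<longleftrightarrow> theory_of M F w \<in> X" for w
    by auto
  then show ?thesis
    by (auto simp: cover_def supports_neg true_at_neg)
qed

lemma cover_in_lang:
  assumes "finite F" "F \<subseteq> lang P n" "X \<subseteq> Pow F"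
  shows "cover F X \<in> lang P n"
proof -
  have "type_fm F T \<in> lang P n" if "T \<in> X" for T
    unfolding type_fm_def
    using that assms by (intro bigconj_in_lang) (auto intro: finite_subset)
  then have "bigidisj (type_fm F ` X) \<in> lang P n"
    using finite_subset_Pow[OF assms(1,3)] by (intro bigidisj_in_lang) auto
  then show ?thesis
    by (simp add: cover_def)
qed

definition omits :: "'p fm set \<Rightarrow> 'p fm set set \<Rightarrow> 'p fm" where
  "omits F X = MImp (cover F X) (bigidisj ((\<lambda>T. cover F (X - {T})) ` X))"

lemma true_at_omits:
  assumes "finite F" "X \<subseteq> Pow F" "X \<noteq> {}"
  shows "true_at M w (omits F X) \<longleftrightarrow> \<not> (\<exists>t\<in>nbhds M w. theory_of M F ` t = X)"
proof -
  have cov: "supports M t (cover F (X - {T})) \<longleftrightarrow> theory_of M F ` t \<subseteq> X - {T}" for t T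
    using assms by (intro supports_cover) auto
  have "(supports M t (cover F X) \<longrightarrow> supports M t (bigidisj ((\<lambda>T. cover F (X - {T})) ` X)))
      \<longleftrightarrow> theory_of M F ` t \<noteq> X" for t
  proof -
    have "supports M t (bigidisj ((\<lambda>T. cover F (X - {T})) ` X)) \<longleftrightarrow>
        t = {} \<or> (\<exists>T\<in>X. theory_of M F ` t \<subseteq> X - {T})"
      using finite_subset_Pow[OF assms(1,2)] by (simp add: supports_bigidisj cov)
    \<comment> \<open>An empty \<open>t\<close> has empty image, so any \<open>T\<close> in the
      nonempty \<open>X\<close> is a witness.\<close>
    also have "\<dots> \<longleftrightarrow> (\<exists>T\<in>X. theory_of M F ` t \<subseteq> X - {T})"
      using assms(3) by auto
    finally show ?thesis
      \<comment> \<open>A subset of \<open>X\<close> is all of \<open>X\<close> iff it is contained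
        in no \<open>X - {T}\<close> with \<open>T\<close> in \<open>X\<close>.\<close>
      unfolding supports_cover[OF assms(1,2)] by blast
  qed
  then show ?thesis
    by (simp add: omits_def true_at_def)
qed

text \<open>The atoms are repeated at each level because valuations must agree at each index of a
  bisimulation.\<close>

primrec basis :: "'p set \<Rightarrow> nat \<Rightarrow> 'p fm set" where
  "basis P 0 = Atom ` P"
| "basis P (Suc n) = Atom ` P \<union> omits (basis P n) ` Pow (Pow (basis P n))"

text \<open>Finiteness survives the double power set, so conjunctions and disjunctions over each
  level are genuine formulas.\<close>

lemma finite_basis: "finite P \<Longrightarrow> finite (basis P n)"
  by (induction n) auto

lemma basis_subset_lang: "finite P \<Longrightarrow> basis P n \<subseteq> lang P n"
proof (induction n)
  case 0
  then show ?case by auto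
next
  case (Suc n)
  let ?F = "basis P n"
  have fin: "finite ?F"
    using Suc.prems by (rule finite_basis)
  have "omits ?F X \<in> lang P (Suc n)" if "X \<subseteq> Pow ?F" for X
  proof -
    have "cover ?F Y \<in> lang P n" if "Y \<subseteq> X" for Y
      using fin Suc that \<open>X \<subseteq> Pow ?F\<close> by (intro cover_in_lang) auto
    then have "bigidisj ((\<lambda>T. cover ?F (X - {T})) ` X) \<in> lang P n"
      using finite_subset_Pow[OF fin that] by (intro bigidisj_in_lang) auto
    with \<open>\<And>Y. Y \<subseteq> X \<Longrightarrow> cover ?F Y \<in> lang P n\<close> show ?thesis
      by (simp add: omits_def)
  qed
  then show ?case by auto
qed

section \<open>Agreement on the basis is a bisimulation\<close>

lemma theory_of_eq_iff:
  "theory_of M F w = theory_of M' F w' \<longleftrightarrow> (\<forall>\<phi>\<in>F. true_at M w \<phi> \<longleftrightarrow> true_at M' w' \<phi>)"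
  by (auto simp: theory_of_def)

text \<open>Turns equality of sets of theories into an Egli-Milner lifting; \<open>A\<close> and
  \<open>B\<close> will be the sets of worlds.\<close>

lemma rel_set_same_image:
  assumes "f ` s = g ` t" "s \<subseteq> A" "t \<subseteq> B"
  shows "rel_set (\<lambda>x y. x \<in> A \<and> y \<in> B \<and> f x = g y) s t"
proof (rule rel_setI)
  fix x assume "x \<in> s"
  then have "f x \<in> g ` t" using assms(1) by blast
  then show "\<exists>y\<in>t. x \<in> A \<and> y \<in> B \<and> f x = g y"
    using \<open>x \<in> s\<close> assms(2,3) by auto
next
  fix y assume "y \<in> t"
  then have "g y \<in> f ` s" using assms(1) by blast
  then show "\<exists>x\<in>s. x \<in> A \<and> y \<in> B \<and> f x = g y"
    using \<open>y \<in> t\<close> assms(2,3) by auto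
qed

text \<open>The index follows the models so that \<open>basis_equiv P M M'\<close> is itself a
  family of relations.\<close>

definition basis_equiv ::
  "'p set \<Rightarrow> ('w, 'p) model \<Rightarrow> ('v, 'p) model \<Rightarrow> nat \<Rightarrow> 'w \<Rightarrow> 'v \<Rightarrow> bool" where
  "basis_equiv P M M' i w w' \<longleftrightarrow> w \<in> worlds M \<and> w' \<in> worlds M' \<and>
     theory_of M (basis P i) w = theory_of M' (basis P i) w'"

lemma rel_set_basis_equiv:
  assumes "theory_of M (basis P i) ` s = theory_of M' (basis P i) ` s'"
    and "s \<subseteq> worlds M" "s' \<subseteq> worlds M'"
  shows "rel_set (basis_equiv P M M' i) s s'"
  using rel_set_same_image[OF assms] by (simp add: basis_equiv_def [abs_def])

text \<open>A nonempty \<open>X\<close> is the set of theories of some neighbourhood iff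
  \<open>omits\<close> for \<open>X\<close> is false, and \<open>w\<close> and \<open>w'\<close>
  agree on these formulas one level up.\<close>

lemma basis_equiv_Suc_nbhds:
  assumes "finite P" and eq: "theory_of M (basis P (Suc i)) w = theory_of M' (basis P (Suc i)) w'"
    and ne: "{} \<notin> nbhds M w" "{} \<notin> nbhds M' w'"
  shows "(\<lambda>s. theory_of M (basis P i) ` s) ` nbhds M w =
         (\<lambda>s. theory_of M' (basis P i) ` s) ` nbhds M' w'"
proof -
  let ?F = "basis P i"
  have iff: "(\<exists>s\<in>nbhds M w. theory_of M ?F ` s = X) \<longleftrightarrow>
      (\<exists>s\<in>nbhds M' w'. theory_of M' ?F ` s = X)" if "X \<subseteq> Pow ?F" for X
  proof (cases "X = {}")
    \<comment> \<open>Only an empty neighbourhood could realize the empty set of theories.\<close>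
    case True
    then show ?thesis using ne by auto
  next
    case False
    have "omits ?F X \<in> basis P (Suc i)"
      using that by auto
    then have "true_at M w (omits ?F X) \<longleftrightarrow> true_at M' w' (omits ?F X)"
      using eq by (simp only: theory_of_eq_iff)
    then show ?thesis
      by (simp only: true_at_omits[OF finite_basis[OF assms(1)] that False] simp_thms)
  qed
  have sub: "theory_of M ?F ` s \<subseteq> Pow ?F" "theory_of M' ?F ` s' \<subseteq> Pow ?F" for s s'
    by (auto simp: theory_of_def)
  show ?thesis
  proof (intro equalityI image_subsetI)
    fix s assume "s \<in> nbhds M w"
    \<comment> \<open>This puts \<open>s\<close> in the form required by \<open>iff\<close>, with
      \<open>X\<close> its own set of theories.\<close>
    then have "\<exists>t\<in>nbhds M w. theory_of M ?F ` t = theory_of M ?F ` s"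
      by (intro bexI[of _ s] refl)
    then obtain s' where "s' \<in> nbhds M' w'" "theory_of M' ?F ` s' = theory_of M ?F ` s"
      unfolding iff[OF sub(1)] by (elim bexE)
    then show "theory_of M ?F ` s \<in> (\<lambda>s. theory_of M' ?F ` s) ` nbhds M' w'"
      by (intro image_eqI[of _ _ s']) simp_all
  next
    fix s assume "s \<in> nbhds M' w'"
    then have "\<exists>t\<in>nbhds M' w'. theory_of M' ?F ` t = theory_of M' ?F ` s"
      by (intro bexI[of _ s] refl)
    then obtain s' where "s' \<in> nbhds M w" "theory_of M ?F ` s' = theory_of M' ?F ` s"
      unfolding iff[OF sub(2), symmetric] by (elim bexE)
    then show "theory_of M' ?F ` s \<in> (\<lambda>s. theory_of M ?F ` s) ` nbhds M w"
      by (intro image_eqI[of _ _ s']) simp_all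
  qed
qed

text \<open>The atoms in the basis yield equal valuations, and its \<open>omits\<close> formulas
  yield the back-and-forth conditions one level down.\<close>

lemma n_bisimulation_basis_equiv:
  assumes "finite P" "in_model M" "in_model M'"
  shows "n_bisimulation P n M M' (basis_equiv P M M')"
  unfolding n_bisimulation_def
proof (intro allI impI)
  fix i w w'
  assume Z: "basis_equiv P M M' i w w'"
  then have w: "w \<in> worlds M" "w' \<in> worlds M'"
    and eq: "theory_of M (basis P i) w = theory_of M' (basis P i) w'"
    by (auto simp: basis_equiv_def)
  have "val M w p \<longleftrightarrow> val M' w' p" if "p \<in> P" for p
  proof -
    have "Atom p \<in> basis P i"
      using that by (cases i) auto
    then have "true_at M w (Atom p) \<longleftrightarrow> true_at M' w' (Atom p)"
      using eq by (simp only: theory_of_eq_iff)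
    then show ?thesis by (simp add: true_at_def)
  qed
  moreover have "(\<forall>s\<in>nbhds M w. \<exists>s'\<in>nbhds M' w'. rel_set (basis_equiv P M M' (i - 1)) s s') \<and>
      (\<forall>s'\<in>nbhds M' w'. \<exists>s\<in>nbhds M w. rel_set (basis_equiv P M M' (i - 1)) s s')" if "i > 0"
  proof -
    let ?F = "basis P (i - 1)"
    have "{} \<notin> nbhds M w" "{} \<notin> nbhds M' w'"
      using w assms(2,3) by (auto simp: in_model_def)
    then have nb: "(\<lambda>s. theory_of M ?F ` s) ` nbhds M w = (\<lambda>s. theory_of M' ?F ` s) ` nbhds M' w'"
      \<comment> \<open>Since \<open>i > 0\<close>, the index \<open>Suc (i - 1)\<close> is
        \<open>i\<close>.\<close>
      using basis_equiv_Suc_nbhds[OF assms(1), of M "i - 1" w M' w'] eq that by simp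
    have rel: "rel_set (basis_equiv P M M' (i - 1)) s s'"
      if "s \<in> nbhds M w" "s' \<in> nbhds M' w'" "theory_of M ?F ` s = theory_of M' ?F ` s'" for s s'
      using that w assms(2,3) by (intro rel_set_basis_equiv) (auto simp: in_model_def)
    show ?thesis
    proof (intro conjI ballI)
      fix s assume s: "s \<in> nbhds M w"
      then have "theory_of M ?F ` s \<in> (\<lambda>s. theory_of M' ?F ` s) ` nbhds M' w'"
        unfolding nb[symmetric] by (rule imageI)
      then obtain s' where "s' \<in> nbhds M' w'" "theory_of M ?F ` s = theory_of M' ?F ` s'"
        by (rule imageE)
      with s show "\<exists>s'\<in>nbhds M' w'. rel_set (basis_equiv P M M' (i - 1)) s s'"
        by (intro bexI[of _ s'] rel)
    next
      fix s' assume s': "s' \<in> nbhds M' w'"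
      then have "theory_of M' ?F ` s' \<in> (\<lambda>s. theory_of M ?F ` s) ` nbhds M w"
        unfolding nb by (rule imageI)
      then obtain s where "s \<in> nbhds M w" "theory_of M' ?F ` s' = theory_of M ?F ` s"
        by (rule imageE)
      with s' show "\<exists>s\<in>nbhds M w. rel_set (basis_equiv P M M' (i - 1)) s s'"
        by (intro bexI[of _ s] rel) simp_all
    qed
  qed
  ultimately show "w \<in> worlds M \<and> w' \<in> worlds M' \<and> (\<forall>p\<in>P. val M w p \<longleftrightarrow> val M' w' p) \<and>
      (i > 0 \<longrightarrow>
        (\<forall>s\<in>nbhds M w. \<exists>s'\<in>nbhds M' w'. rel_set (basis_equiv P M M' (i - 1)) s s') \<and>
        (\<forall>s'\<in>nbhds M' w'. \<exists>s\<in>nbhds M w. rel_set (basis_equiv P M M' (i - 1)) s s'))"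
    using w by blast
qed

section \<open>From logical equivalence to agreement on the basis\<close>

lemma world_equiv_imp_basis_equiv:
  assumes "finite P" "w \<in> worlds M" "w' \<in> worlds M'" "world_equiv P n M w M' w'"
  shows "basis_equiv P M M' n w w'"
  using assms basis_subset_lang[OF assms(1), of n]
  by (auto simp: basis_equiv_def theory_of_eq_iff world_equiv_def lang_def)

text \<open>The \<open>cover\<close> formulas have depth at most \<open>n\<close>, so both states
  have the same upper bounds for their sets of theories. Taking each of these sets as the bound
  gives both inclusions.\<close>

lemma state_equiv_imp_theories_eq:
  assumes "finite P" "state_equiv P n M s M' s'"
  shows "theory_of M (basis P n) ` s = theory_of M' (basis P n) ` s'"
proof -
  let ?F = "basis P n"
  have iff: "theory_of M ?F ` s \<subseteq> X \<longleftrightarrow> theory_of M' ?F ` s' \<subseteq> X" if "X \<subseteq> Pow ?F" for X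
  proof -
    have "cover ?F X \<in> lang P n"
      using finite_basis[OF assms(1)] basis_subset_lang[OF assms(1)] that by (rule cover_in_lang)
    then have "supports M s (cover ?F X) \<longleftrightarrow> supports M' s' (cover ?F X)"
      using assms(2) by (simp add: state_equiv_def lang_def)
    then show ?thesis
      by (simp add: supports_cover[OF finite_basis[OF assms(1)] that])
  qed
  have "theory_of M ?F ` s \<subseteq> Pow ?F" "theory_of M' ?F ` s' \<subseteq> Pow ?F"
    by (auto simp: theory_of_def)
  from iff[OF this(1)] iff[OF this(2)] show ?thesis
    by (simp add: subset_antisym)
qed

theorem theorem5p10:
  fixes P :: "'p set" and n :: nat
    and M :: "('w, 'p) model" and M' :: "('v, 'p) model"
  assumes "finite P" and "in_model M" and "in_model M'"
  shows "(\<forall>w\<in>worlds M. \<forall>w'\<in>worlds M'.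
            world_equiv P n M w M' w' \<longrightarrow> world_bisim P n M w M' w') \<and>
         (\<forall>s s'. s \<subseteq> worlds M \<longrightarrow> s' \<subseteq> worlds M' \<longrightarrow>
            state_equiv P n M s M' s' \<longrightarrow> state_bisim P n M s M' s')"
proof -
  \<comment> \<open>The family \<open>basis_equiv P M M'\<close> is the witness for worlds and for
    states.\<close>
  have "world_bisim P n M w M' w'"
    if "w \<in> worlds M" "w' \<in> worlds M'" "world_equiv P n M w M' w'" for w w'
    using n_bisimulation_basis_equiv[OF assms] world_equiv_imp_basis_equiv[OF assms(1) that]
    unfolding world_bisim_def by blast
  moreover have "state_bisim P n M s M' s'"
    if "s \<subseteq> worlds M" "s' \<subseteq> worlds M'" "state_equiv P n M s M' s'" for s s'
    using n_bisimulation_basis_equiv[OF assms]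
      rel_set_basis_equiv[OF state_equiv_imp_theories_eq[OF assms(1) that(3)] that(1,2)]
    unfolding state_bisim_def by blast
  ultimately show ?thesis by blast
qed

end
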